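(* Let $D$ be a connected acyclic digraph of order $n$. Then for each $i\in\{1,2,\ldots,n\}$ there exist at least $n-i+1$ connected convex sets in $D$ of order (cardinality) $i$.
   Context: All digraphs are finite; the order of a digraph is its number of vertices. A digraph is acyclic if it has no directed cycle, and connected if its underlying undirected graph is connected. A non-empty set $X$ of vertices of an acyclic digraph $D$ is connected if the underlying undirected graph of the induced subdigraph $D[X]$ is connected. A non-empty set $X$ of vertices of $D$ is convex if there is no directed path in $D$ between two vertices of $X$ that contains a vertex not in $X$. A connected convex set is a set that is both connected and convex. *)

theory Defs
  imports "Graph_Theory.Graph_Theory"
begin

definition acyclic_digraph :: "('a, 'b) pre_digraph \<Rightarrow> bool" where
  "acyclic_digraph D \<longleftrightarrow> \<not> (\<exists>p. pre_digraph.cycle D p)"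

definition connected_set :: "('a, 'b) pre_digraph \<Rightarrow> 'a set \<Rightarrow> bool" where
  "connected_set D X \<longleftrightarrow>
     X \<noteq> {} \<and> X \<subseteq> verts D \<and> Digraph_Component.connected (D \<restriction> X)"

(* Paths do not repeat vertices.  The vertices u and v range over all ordered pairs, so paths
   in either direction are covered. *)
definition convex_set :: "('a, 'b) pre_digraph \<Rightarrow> 'a set \<Rightarrow> bool" where
  "convex_set D X \<longleftrightarrow>
     X \<noteq> {} \<and> X \<subseteq> verts D \<and>
     \<not> (\<exists>u\<in>X. \<exists>v\<in>X. \<exists>p. pre_digraph.apath D u p v \<and>
           (\<exists>w\<in>set (pre_digraph.awalk_verts D u p). w \<notin> X))"

definition connected_convex_set :: "('a, 'b) pre_digraph \<Rightarrow> 'a set \<Rightarrow> bool" where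
  "connected_convex_set D X \<longleftrightarrow> connected_set D X \<and> convex_set D X"

end

theory Submission
  imports Defs
begin

text \<open>
  A connected acyclic digraph with at least two vertices has, besides any prescribed vertex
  \<open>x\<close>, a source or sink \<open>y\<close> whose removal keeps the digraph connected: choose \<open>y\<close> so that the
  component of \<open>x\<close> after removing \<open>y\<close> is as large as possible. If, say, \<open>y\<close> is a source and some
  vertices lie outside that component, then a sink among those vertices would have been a better
  choice. Removing a source or sink from a convex set leaves a convex set. Hence every vertex
  lies in connected convex sets of all orders, and an induction removing one vertex \<open>y\<close> gives
  the bound: besides the sets avoiding \<open>y\<close> there is at least one that contains \<open>y\<close>.
\<close>

text \<open>\<open>rtrancl_on X\<close> confines walks to \<open>X\<close>, so \<open>E\<close> can
  stay fixed while \<open>X\<close> shrinks. The empty set satisfies this; non-emptiness is supplied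
  separately.\<close>

definition weakly_connected_on :: "'a rel \<Rightarrow> 'a set \<Rightarrow> bool" where
  "weakly_connected_on E X \<longleftrightarrow> (\<forall>u\<in>X. \<forall>v\<in>X. (u, v) \<in> rtrancl_on X (E\<^sup>s))"

text \<open>Reachability is taken in all of \<open>E\<close>, not inside \<open>X\<close>, so that
  convexity keeps referring to the whole digraph. Walks replace paths, which avoids any bookkeeping
  about repeated vertices.\<close>

definition rel_convex :: "'a rel \<Rightarrow> 'a set \<Rightarrow> bool" where
  "rel_convex E X \<longleftrightarrow>
     (\<forall>u\<in>X. \<forall>v\<in>X. \<forall>w. (u, w) \<in> E\<^sup>* \<longrightarrow> (w, v) \<in> E\<^sup>* \<longrightarrow> w \<in> X)"

definition source_or_sink :: "'a rel \<Rightarrow> 'a set \<Rightarrow> 'a \<Rightarrow> bool" where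
  "source_or_sink E X y \<longleftrightarrow> y \<in> X \<and> ((\<forall>w\<in>X. (w, y) \<notin> E) \<or> (\<forall>w\<in>X. (y, w) \<notin> E))"

lemma symcl_conv: "E\<^sup>s = E \<union> E\<inverse>"
  by (auto simp: symcl_def)

lemma sym_symcl: "sym (E\<^sup>s)"
  by (auto simp: sym_def symcl_conv)

lemma symcl_converse: "(E\<inverse>)\<^sup>s = E\<^sup>s"
  by (auto simp: symcl_conv)

lemma source_or_sink_converse: "source_or_sink (E\<inverse>) X y \<longleftrightarrow> source_or_sink E X y"
  by (auto simp: source_or_sink_def)

lemma weakly_connected_onI:
  assumes "\<And>v. v \<in> X \<Longrightarrow> (x, v) \<in> rtrancl_on X (E\<^sup>s)"
  shows "weakly_connected_on E X"
  unfolding weakly_connected_on_def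
proof (intro ballI)
  fix u v assume "u \<in> X" "v \<in> X"
  then have xu: "(x, u) \<in> rtrancl_on X (E\<^sup>s)" and xv: "(x, v) \<in> rtrancl_on X (E\<^sup>s)"
    using assms by simp_all
  from symD[OF rtrancl_on_sym[OF sym_symcl] xu] xv show "(u, v) \<in> rtrancl_on X (E\<^sup>s)"
    by (rule rtrancl_on_trans)
qed

section \<open>Removing a source or sink without disconnecting\<close>

lemma acyclic_has_sink:
  assumes "acyclic E" "finite X" "X \<noteq> {}"
  obtains z where "z \<in> X" "\<And>w. w \<in> X \<Longrightarrow> (z, w) \<notin> E"
proof -
  have wf: "wf ((Restr E X)\<inverse>)"
    using assms(2) acyclic_subset[OF assms(1)] by (intro finite_acyclic_wf_converse) auto
  have "\<exists>z\<in>X. \<forall>w\<in>X. (z, w) \<notin> E"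
    using wf[unfolded wf_eq_minimal, THEN spec, of X] assms(3) by auto
  then show ?thesis using that by blast
qed

text \<open>A walk from \<open>x\<close> in \<open>Y\<close> meets only vertices of the component of
  \<open>x\<close>, so it survives in every \<open>Z\<close> containing that component.\<close>

lemma rtrancl_on_subset_component:
  assumes "(x, c) \<in> rtrancl_on Y r" "x \<in> Z"
    and "\<And>v. (x, v) \<in> rtrancl_on Y r \<Longrightarrow> v \<in> Z"
  shows "(x, c) \<in> rtrancl_on Z r"
  using assms(1)
proof (induct rule: rtrancl_on_induct)
  case (step a b)
  have "b \<in> Z" by (rule assms(3)) (rule rtrancl_on_into_rtrancl_on[OF step(1,2,4)])
  with step(5,2) show ?case by (rule rtrancl_on_into_rtrancl_on)
qed (simp add: assms(2))

text \<open>The witness \<open>z\<close> is a sink among the vertices outside \<open>C\<close> and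
  different from \<open>y\<close>. Deleting \<open>z\<close> instead of \<open>y\<close> leaves
  \<open>C\<close> intact and lets \<open>y\<close> join it.\<close>

lemma larger_component:
  assumes "acyclic E" "finite X" "weakly_connected_on E X" "x \<in> X"
    and y: "y \<in> X" "y \<noteq> x" "\<And>w. w \<in> X \<Longrightarrow> (w, y) \<notin> E"
    and C: "C = {v. (x, v) \<in> rtrancl_on (X - {y}) (E\<^sup>s)}" "C \<noteq> X - {y}"
  shows "\<exists>z. source_or_sink E X z \<and> z \<noteq> x \<and>
           C \<subset> {v. (x, v) \<in> rtrancl_on (X - {z}) (E\<^sup>s)}"
proof -
  have CX: "C \<subseteq> X - {y}" and xC: "x \<in> C"
    using C(1) y assms(4) by (auto dest: in_rtrancl_on_in_F)
  have C_closed: "b \<in> C" if "a \<in> C" "(a, b) \<in> E\<^sup>s" "b \<in> X - {y}" for a b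
    using that rtrancl_on_into_rtrancl_on[of x a] C(1) by simp
  obtain z where z: "z \<in> X - {y} - C" "\<And>w. w \<in> X - {y} - C \<Longrightarrow> (z, w) \<notin> E"
    using acyclic_has_sink[of E "X - {y} - C"] assms(1,2) CX C(2) by auto
  \<comment> \<open>An arc from \<open>z\<close> could only end in \<open>C\<close>, since
    \<open>y\<close> is a source; but then \<open>z\<close> itself would belong to the component
    \<open>C\<close>.\<close>
  have "(z, w) \<notin> E" if "w \<in> X" for w
  proof
    assume zw: "(z, w) \<in> E"
    then have "w \<in> C" using z that y(3)[of z] by auto
    then show False using C_closed[of w z] zw z(1) by (auto simp: symcl_conv)
  qed
  then have sink: "source_or_sink E X z" using z(1) by (auto simp: source_or_sink_def)
  have sub: "C \<subseteq> {v. (x, v) \<in> rtrancl_on (X - {z}) (E\<^sup>s)}"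
  proof
    fix c assume "c \<in> C"
    then have "(x, c) \<in> rtrancl_on (X - {y}) (E\<^sup>s)" by (simp add: C(1))
    then have "(x, c) \<in> rtrancl_on (X - {z}) (E\<^sup>s)"
      by (rule rtrancl_on_subset_component) (use C(1) z(1) CX xC in auto)
    then show "c \<in> {v. (x, v) \<in> rtrancl_on (X - {z}) (E\<^sup>s)}" by simp
  qed
  \<comment> \<open>If no vertex of \<open>C\<close> were adjacent to \<open>y\<close>, a walk in
    \<open>X\<close> from \<open>x\<close> to \<open>y\<close> could never leave
    \<open>C\<close>.\<close>
  obtain c where c: "c \<in> C" "(c, y) \<in> E\<^sup>s"
  proof (rule ccontr)
    assume neg: "\<not> thesis"
    have "(x, y) \<in> rtrancl_on X (E\<^sup>s)"
      using assms(3,4) y(1) by (simp add: weakly_connected_on_def)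
    then have "y \<in> C"
    proof (induct rule: rtrancl_on_induct)
      case (step a b)
      then have "b \<noteq> y" using neg that by blast
      with step show ?case using C_closed[of a b] by blast
    qed (rule xC)
    then show False using CX by auto
  qed
  have "(x, y) \<in> rtrancl_on (X - {z}) (E\<^sup>s)"
    using c sub y(1) z(1) by (rule_tac rtrancl_on_into_rtrancl_on[of x c]) auto
  then have "C \<subset> {v. (x, v) \<in> rtrancl_on (X - {z}) (E\<^sup>s)}"
    using sub CX by auto
  then show ?thesis using sink z(1) xC by auto
qed

text \<open>Orient the arcs so that \<open>x\<close> has an out-neighbour in \<open>X\<close>; a
  sink for this orientation is then different from \<open>x\<close>.\<close>

lemma ex_source_or_sink_neq:
  assumes "acyclic E" "finite X" "weakly_connected_on E X" "x \<in> X" "X \<noteq> {x}"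
  obtains y where "source_or_sink E X y" "y \<noteq> x"
proof -
  obtain v where v: "v \<in> X" "v \<noteq> x" using assms(4,5) by auto
  then have "(x, v) \<in> rtrancl_on X (E\<^sup>s)"
    using assms(3,4) by (simp add: weakly_connected_on_def)
  then obtain w where w: "(x, w) \<in> E\<^sup>s" "w \<in> X"
  proof (cases rule: converse_rtrancl_on_cases)
    case (step c)
    then show ?thesis using that in_rtrancl_on_in_F(1)[OF step(2)] by blast
  qed (use v in simp)
  then obtain F where F: "F = E \<or> F = E\<inverse>" "(x, w) \<in> F"
    by (auto simp: symcl_conv)
  then have "acyclic F" using assms(1) by auto
  then obtain z where z: "z \<in> X" "\<And>w. w \<in> X \<Longrightarrow> (z, w) \<notin> F"
    using acyclic_has_sink assms(2,4) by blast
  then have "source_or_sink F X z" "z \<noteq> x" using F(2) w(2) by (auto simp: source_or_sink_def)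
  then show ?thesis using that[of z] F(1) by (auto simp: source_or_sink_converse)
qed

lemma ex_removable_neq:
  assumes "acyclic E" "finite X" "weakly_connected_on E X" "x \<in> X" "X \<noteq> {x}"
  obtains y where "source_or_sink E X y" "y \<noteq> x" "weakly_connected_on E (X - {y})"
proof -
  define comp where "comp y = {v. (x, v) \<in> rtrancl_on (X - {y}) (E\<^sup>s)}" for y
  define Y where "Y = {y. source_or_sink E X y \<and> y \<noteq> x}"
  have comp_sub: "comp y \<subseteq> X - {y}" for y
    by (auto simp: comp_def dest: in_rtrancl_on_in_F)
  have fin: "finite Y" using assms(2) by (rule rev_finite_subset) (auto simp: Y_def source_or_sink_def)
  moreover have "Y \<noteq> {}"
    using ex_source_or_sink_neq[OF assms] by (auto simp: Y_def)
  ultimately have "Max ((\<lambda>y. card (comp y)) ` Y) \<in> (\<lambda>y. card (comp y)) ` Y"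
    by (intro Max_in) auto
  then obtain y where y: "y \<in> Y" "card (comp y) = Max ((\<lambda>y. card (comp y)) ` Y)"
    by auto
  have y_max: "card (comp z) \<le> card (comp y)" if "z \<in> Y" for z
    using that fin by (simp add: y(2))
  have "comp y = X - {y}"
  proof (rule ccontr)
    assume neq: "comp y \<noteq> X - {y}"
    have yX: "y \<in> X" "y \<noteq> x" using y(1) by (auto simp: Y_def source_or_sink_def)
    \<comment> \<open>Reversing all arcs if \<open>y\<close> is a sink makes it a source, while
      symmetric closure and components stay the same.\<close>
    obtain F where F: "F = E \<or> F = E\<inverse>" "\<And>w. w \<in> X \<Longrightarrow> (w, y) \<notin> F"
      using y(1) by (force simp: Y_def source_or_sink_def)
    have Fs: "F\<^sup>s = E\<^sup>s" using F(1) by (auto simp: symcl_converse)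
    have "acyclic F" "weakly_connected_on F X"
      using F(1) assms(1,3) by (auto simp: weakly_connected_on_def Fs)
    from larger_component[OF this(1) assms(2) this(2) assms(4) yX F(2) _ neq]
    obtain z where z: "source_or_sink F X z" "z \<noteq> x" "comp y \<subset> comp z"
      by (auto simp: comp_def Fs)
    have "z \<in> Y" using z(1,2) F(1) by (auto simp: Y_def source_or_sink_converse)
    moreover have "finite (comp z)" using comp_sub[of z] assms(2) finite_subset[of "comp z"] by simp
    ultimately show False using y_max[of z] psubset_card_mono[of "comp z", OF _ z(3)] by simp
  qed
  then have "weakly_connected_on E (X - {y})"
    by (intro weakly_connected_onI[of _ x]) (auto simp: comp_def)
  then show ?thesis using that y(1) by (auto simp: Y_def)
qed

section \<open>Convexity under removal, and the count\<close>

lemma rel_convex_remove: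
  assumes "rel_convex E X" "source_or_sink E X y"
  shows "rel_convex E (X - {y})"
  unfolding rel_convex_def
proof (intro ballI allI impI)
  fix u v w assume uv: "u \<in> X - {y}" "v \<in> X - {y}" and uw: "(u, w) \<in> E\<^sup>*" and wv: "(w, v) \<in> E\<^sup>*"
  have conv: "b \<in> X" if "(u, b) \<in> E\<^sup>*" "(b, v) \<in> E\<^sup>*" for b
    using assms(1) uv that unfolding rel_convex_def by blast
  have "w \<noteq> y"
  proof
    assume [simp]: "w = y"
    obtain a where a: "(u, a) \<in> E\<^sup>*" "(a, y) \<in> E"
      using uw uv by (auto elim: rtranclE)
    obtain b where b: "(y, b) \<in> E" "(b, v) \<in> E\<^sup>*"
      using wv uv by (auto elim: converse_rtranclE)
    \<comment> \<open>The neighbours \<open>a\<close> and \<open>b\<close> of \<open>y\<close> lie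
      on a walk from \<open>u\<close> to \<open>v\<close>, so convexity puts them in
      \<open>X\<close>, where \<open>y\<close> then has both an in- and an out-neighbour.\<close>
    have "a \<in> X" "b \<in> X"
      using conv[of a] conv[of b] a b uw wv by (auto intro: converse_rtrancl_into_rtrancl rtrancl_into_rtrancl)
    then show False using assms(2) a b by (auto simp: source_or_sink_def)
  qed
  then show "w \<in> X - {y}" using conv uw wv by auto
qed

text \<open>Vertices other than \<open>x\<close> are removed one at a time until \<open>i\<close>
  remain. In the count below this is applied to the deleted vertex.\<close>

lemma ex_connected_convex_containing:
  assumes "acyclic E" "finite X" "weakly_connected_on E X" "rel_convex E X" "x \<in> X"
    and "1 \<le> i" "i \<le> card X"
  shows "\<exists>Y\<subseteq>X. x \<in> Y \<and> weakly_connected_on E Y \<and> rel_convex E Y \<and> card Y = i"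
  using assms(2-5,7)
proof (induction "card X" arbitrary: X rule: less_induct)
  case less
  show ?case
  proof (cases "i = card X")
    case False
    then have i: "i < card X" using less.prems by simp
    with assms(6) have "X \<noteq> {x}" by auto
    then obtain y where y: "source_or_sink E X y" "y \<noteq> x" "weakly_connected_on E (X - {y})"
      using ex_removable_neq assms(1) less.prems by metis
    then have "card (X - {y}) = card X - 1" by (simp add: source_or_sink_def)
    then have "\<exists>Y\<subseteq>X - {y}. x \<in> Y \<and> weakly_connected_on E Y \<and> rel_convex E Y \<and> card Y = i"
      using less.prems y i rel_convex_remove[OF _ y(1)] by (intro less.hyps) auto
    then show ?thesis by blast
  next
    case True
    then show ?thesis using less.prems by (intro exI[of _ X]) simp
  qed
qed

lemma card_connected_convex_ge:
  assumes "acyclic E" "finite X" "weakly_connected_on E X" "rel_convex E X"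
    and "1 \<le> i" "i \<le> card X"
  shows "card X - i + 1 \<le>
    card {Y. Y \<subseteq> X \<and> weakly_connected_on E Y \<and> rel_convex E Y \<and> card Y = i}"
  using assms(2-4,6)
proof (induction "card X" arbitrary: X rule: less_induct)
  case less
  let ?S = "\<lambda>X. {Y. Y \<subseteq> X \<and> weakly_connected_on E Y \<and> rel_convex E Y \<and> card Y = i}"
  have fin: "finite (?S Z)" if "finite Z" for Z
    using that by (auto intro: finite_subset[of _ "Pow Z"])
  have "X \<noteq> {}" using less.prems assms(5) by auto
  then obtain x where x: "x \<in> X" by auto
  show ?case
  proof (cases "i = card X")
    case True
    then have "X \<in> ?S X" using less.prems by auto
    then have "0 < card (?S X)" using fin less.prems by (auto simp: card_gt_0_iff)
    then show ?thesis using True by simp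
  next
    case False
    then have i: "i < card X" using less.prems by simp
    with assms(5) have "X \<noteq> {x}" by auto
    then obtain y where y: "source_or_sink E X y" "weakly_connected_on E (X - {y})"
      using ex_removable_neq assms(1) less.prems x by metis
    then have yX: "y \<in> X" by (simp add: source_or_sink_def)
    obtain Y where Y: "Y \<in> ?S X" "y \<in> Y"
      using ex_connected_convex_containing[OF assms(1) less.prems(1-3) yX assms(5) less.prems(4)]
      by blast
    have "card (X - {y}) = card X - 1" using yX by simp
    \<comment> \<open>The induction hypothesis gives \<open>card X - 1 - i + 1\<close>, which equals
      \<open>card X - i\<close> because \<open>i < card X\<close>.\<close>
    then have "card X - i \<le> card (?S (X - {y}))"
      using less.hyps[of "X - {y}"] less.prems y i rel_convex_remove[OF _ y(1)]
      by (simp add: Suc_diff_Suc)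
    then have "card X - i + 1 \<le> card (insert Y (?S (X - {y})))"
      using Y(2) fin[of "X - {y}"] less.prems(1) by (subst card_insert_disjoint) auto
    also have "\<dots> \<le> card (?S X)"
      using Y(1) fin less.prems(1) by (intro card_mono) auto
    finally show ?thesis .
  qed
qed

section \<open>Transfer from relations to digraphs\<close>

lemma connected_induce_iff:
  "Digraph_Component.connected (D \<restriction> X) \<longleftrightarrow> X \<noteq> {} \<and> weakly_connected_on (arcs_ends D) X"
proof -
  let ?r = "parcs (mk_symmetric (D \<restriction> X))"
  have r: "?r = Restr ((arcs_ends D)\<^sup>s) X"
    by (auto simp: parcs_mk_symmetric symcl_def arcs_ends_conv)
  \<comment> \<open>Walks on both sides stay inside \<open>X\<close>, so restricting the arcs to
    \<open>X\<close> changes nothing.\<close>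
  have "rtrancl_on X ?r = rtrancl_on X ((arcs_ends D)\<^sup>s)"
  proof (intro set_eqI iffI; clarify)
    fix u v
    show "(u, v) \<in> rtrancl_on X ((arcs_ends D)\<^sup>s)" if "(u, v) \<in> rtrancl_on X ?r"
      using that by (rule rtrancl_on_mono[rotated 2]) (auto simp: r)
    show "(u, v) \<in> rtrancl_on X ?r" if "(u, v) \<in> rtrancl_on X ((arcs_ends D)\<^sup>s)"
      using that
    proof (induct rule: rtrancl_on_induct)
      case (step a b)
      then show ?case by (rule_tac rtrancl_on_into_rtrancl_on[of u a]) (auto simp: r)
    qed simp
  qed
  then show ?thesis
    by (simp add: connected_def strongly_connected_def reachable_def weakly_connected_on_def)
qed

lemma (in wf_digraph) acyclic_arcs_ends:
  assumes "acyclic_digraph G"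
  shows "acyclic (arcs_ends G)"
  using assms closed_w_imp_cycle
  by (auto simp: acyclic_def acyclic_digraph_def reachable1_awalk closed_w_def)

text \<open>Every vertex of a path is reachable from its start and reaches its end. This one
  direction suffices for a lower bound on the number of sets.\<close>

lemma (in wf_digraph) convex_setI:
  assumes "rel_convex (arcs_ends G) X" "X \<noteq> {}" "X \<subseteq> verts G"
  shows "convex_set G X"
  unfolding convex_set_def
proof (intro conjI assms notI)
  assume "\<exists>u\<in>X. \<exists>v\<in>X. \<exists>p. apath u p v \<and> (\<exists>w\<in>set (awalk_verts u p). w \<notin> X)"
  then obtain u v p w where *: "u \<in> X" "v \<in> X" "awalk u p v" "w \<in> set (awalk_verts u p)" "w \<notin> X"
    by (auto simp: apath_def)
  then have "(u, w) \<in> (arcs_ends G)\<^sup>*" "(w, v) \<in> (arcs_ends G)\<^sup>*"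
    using awalk_verts_reachable_from[OF *(3,4)] awalk_verts_reachable_to[OF *(3,4)]
    by (auto simp: reachable_def intro: rtrancl_on_rtranclI)
  then show False using *(1,2,5) assms(1) unfolding rel_convex_def by blast
qed

theorem theorem3p3:
  fixes D :: "('a, 'b) pre_digraph" and n :: nat
  assumes "digraph D"
    and "Digraph_Component.connected D"
    and "acyclic_digraph D"
    and "card (verts D) = n"
  shows "\<forall>i\<in>{1..n}. card {X. connected_convex_set D X \<and> card X = i} \<ge> n - i + 1"
proof
  fix i assume i: "i \<in> {1..n}"
  interpret digraph D by fact
  let ?E = "arcs_ends D"
  have "D \<restriction> verts D = D"
    by (auto simp: induce_subgraph_def intro!: pre_digraph.equality)
  then have conn: "weakly_connected_on ?E (verts D)"
    using assms(2) connected_induce_iff[of D "verts D"] by simp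
  have conv: "rel_convex ?E (verts D)"
    unfolding rel_convex_def
    by (metis adj_in_verts(2) rtranclE)
  have "n - i + 1 \<le> card {X. X \<subseteq> verts D \<and> weakly_connected_on ?E X \<and> rel_convex ?E X \<and> card X = i}"
    using card_connected_convex_ge[OF acyclic_arcs_ends[OF assms(3)] finite_verts conn conv] i assms(4)
    by simp
  also have "\<dots> \<le> card {X. connected_convex_set D X \<and> card X = i}"
  proof (rule card_mono)
    \<comment> \<open>An infinite set has \<open>card\<close> 0, so monotonicity of
      \<open>card\<close> requires the larger family to be finite.\<close>
    show "finite {X. connected_convex_set D X \<and> card X = i}"
      by (rule finite_subset[of _ "Pow (verts D)"])
        (auto simp: connected_convex_set_def connected_set_def)
  next
    have "connected_convex_set D X"
      if "X \<subseteq> verts D" "weakly_connected_on ?E X" "rel_convex ?E X" "card X = i" for X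
    proof -
      have "X \<noteq> {}" using that i by auto
      then show ?thesis
        using that convex_setI
        by (simp add: connected_convex_set_def connected_set_def connected_induce_iff)
    qed
    then show "{X. X \<subseteq> verts D \<and> weakly_connected_on ?E X \<and> rel_convex ?E X \<and> card X = i}
      \<subseteq> {X. connected_convex_set D X \<and> card X = i}"
      by auto
  qed
  finally show "n - i + 1 \<le> card {X. connected_convex_set D X \<and> card X = i}" .
qed

end
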